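(* Let $\mathbf{S}\subset\mathbb{R}^n$ be a nonempty compact basic semi-algebraic set, $f:\mathbb{R}^n\to\mathbb{R}^m$ a polynomial map, $\mathbf{B}\subset\mathbb{R}^m$ a compact basic semi-algebraic set with $\mathbf{F}:=f(\mathbf{S})\subset\mathbf{B}$, and let $h_f(\mathbf{x},\mathbf{y}):=-\|\mathbf{y}-f(\mathbf{x})\|_2^2$ and $h(\mathbf{y}):=\sup_{\mathbf{x}\in\mathbf{S}}h_f(\mathbf{x},\mathbf{y})$. Let $(p_r)_{r\in\mathbb{N}}\subset\mathbb{R}[\mathbf{y}]$ be a sequence of polynomials such that $p_r(\mathbf{y})\ge h_f(\mathbf{x},\mathbf{y})$ for all $r\in\mathbb{N}$, $\mathbf{x}\in\mathbf{S}$, $\mathbf{y}\in\mathbf{B}$, and $\lim_{r\to\infty}\int|p_r(\mathbf{y})-h(\mathbf{y})|\,\lambda_{\mathbf{B}}(d\mathbf{y})=0$. For each $r\in\mathbb{N}$ define $\mathbf{F}_r:=\{\mathbf{y}\in\mathbf{B}:p_r(\mathbf{y})\ge0\}$. Then $\mathbf{F}_r\supset\mathbf{F}$ for every $r$, and $$\lim_{r\to\infty}\operatorname{vol}(\mathbf{F}_r\setminus\mathbf{F})=0.$$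
   Context: A basic semi-algebraic set is one of the form $\{g_1\ge0,\dots,g_k\ge0\}$ for finitely many real polynomials $g_i$. $\lambda_{\mathbf{B}}$ denotes the restriction of Lebesgue measure on $\mathbb{R}^m$ to $\mathbf{B}$, and $\operatorname{vol}$ denotes Lebesgue measure on $\mathbb{R}^m$. *)

theory Defs
  imports "HOL-Analysis.Analysis"
begin

definition basic_semialgebraic :: "(real ^ 'n) set \<Rightarrow> bool" where
  "basic_semialgebraic S \<longleftrightarrow>
     (\<exists>G. finite G \<and> (\<forall>g\<in>G. real_polynomial_function g) \<and> S = {x. \<forall>g\<in>G. g x \<ge> 0})"

definition neg_sq_dist :: "(real ^ 'n \<Rightarrow> real ^ 'm) \<Rightarrow> real ^ 'n \<Rightarrow> real ^ 'm \<Rightarrow> real" where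
  "neg_sq_dist f x y = - (norm (y - f x))\<^sup>2"

text \<open>The supremum is a genuine one for nonempty \<open>S\<close>: the values are bounded above by 0.\<close>

definition sup_neg_sq_dist ::
    "(real ^ 'n) set \<Rightarrow> (real ^ 'n \<Rightarrow> real ^ 'm) \<Rightarrow> real ^ 'm \<Rightarrow> real" where
  "sup_neg_sq_dist S f y = (SUP x\<in>S. neg_sq_dist f x y)"

definition superlevel_set :: "(real ^ 'm) set \<Rightarrow> (real ^ 'm \<Rightarrow> real) \<Rightarrow> (real ^ 'm) set" where
  "superlevel_set B p = {y \<in> B. p y \<ge> 0}"

end

theory Submission
  imports Defs
begin

text \<open>Up to sign, \<open>h\<close> is the squared distance to the compact set \<open>f(S)\<close>, hence continuous and
  negative exactly off \<open>f(S)\<close>. On \<open>F\<^sub>r - f(S)\<close> we have \<open>p\<^sub>r \<ge> 0 > h\<close>, so for every \<open>\<delta> > 0\<close> each such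
  point has \<open>-\<delta> < h < 0\<close> or \<open>\<bar>p\<^sub>r - h\<bar> \<ge> \<delta>\<close>. The first set shrinks to the empty set as \<open>\<delta>\<close> tends
  to 0, and by Markov's inequality the measure of the second one tends to 0 with \<open>r\<close>.\<close>

text \<open>The distance from \<open>y\<close> to the compact set f(S) is attained, so the supremum
  is a maximum, reached at any preimage in \<open>S\<close> of a nearest point.\<close>

lemma sup_neg_sq_dist_eq_infdist:
  assumes "S \<noteq> {}" and "compact (f ` S)"
  shows "sup_neg_sq_dist S f y = - (infdist y (f ` S))\<^sup>2"
  unfolding sup_neg_sq_dist_def
proof (rule cSup_eq_maximum)
  have "closed (f ` S)" "f ` S \<noteq> {}"
    using assms compact_imp_closed by auto
  then obtain z where z: "z \<in> f ` S" "infdist y (f ` S) = dist y z"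
    using infdist_attains_inf by metis
  then show "- (infdist y (f ` S))\<^sup>2 \<in> (\<lambda>x. neg_sq_dist f x y) ` S"
    by (auto simp: neg_sq_dist_def dist_norm)
next
  fix v assume "v \<in> (\<lambda>x. neg_sq_dist f x y) ` S"
  then obtain x where x: "x \<in> S" "v = - (dist y (f x))\<^sup>2"
    by (auto simp: neg_sq_dist_def dist_norm)
  then show "v \<le> - (infdist y (f ` S))\<^sup>2"
    by (simp add: infdist_le infdist_nonneg power_mono)
qed

lemma integrable_lebesgue_on_continuous_compact:
  fixes g :: "'a::euclidean_space \<Rightarrow> real"
  assumes "compact B" and "continuous_on B g"
  shows "integrable (lebesgue_on B) g"
proof -
  have B: "B \<in> sets lebesgue"
    using assms(1) by (simp add: compact_imp_closed borel_closed sets_completionI_sets)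
  interpret finite_measure "lebesgue_on B"
    by (rule finite_measure_lebesgue_on) (simp add: assms(1) lmeasurable_compact)
  obtain c where "\<forall>x\<in>B. norm (g x) \<le> c"
    using compact_imp_bounded[OF compact_continuous_image[OF assms(2,1)]]
    by (auto simp: bounded_iff)
  moreover have "g \<in> borel_measurable (lebesgue_on B)"
    using B assms(2) by (rule continuous_imp_measurable_on_sets_lebesgue[rotated])
  ultimately show ?thesis
    by (intro integrable_const_bound[where B = c]) auto
qed

text \<open>The measure-theoretic core, free of polynomials and geometry. Finiteness of the measure
  gives continuity from above along the strips \<open>A k\<close> just below the zero level of
  \<open>h\<close>.\<close>

lemma (in finite_measure) tendsto_measure_nonneg_of_L1_neg:
  fixes q :: "nat \<Rightarrow> 'a \<Rightarrow> real" and h :: "'a \<Rightarrow> real"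
  assumes q: "\<And>r. integrable M (q r)" and h: "integrable M h"
    and lim: "(\<lambda>r. LINT x|M. \<bar>q r x - h x\<bar>) \<longlonglongrightarrow> 0"
  shows "(\<lambda>r. measure M {x \<in> space M. q r x \<ge> 0 \<and> h x < 0}) \<longlonglongrightarrow> 0"
proof (rule LIMSEQ_I)
  fix e :: real assume e: "e > 0"
  have [measurable]: "h \<in> borel_measurable M" "\<And>r. q r \<in> borel_measurable M"
    using q h by auto
  define d :: "nat \<Rightarrow> real" where "d k = 1 / real (Suc k)" for k
  define A where "A k = {x \<in> space M. - d k < h x \<and> h x < 0}" for k
  have "d j \<le> d i" if "i \<le> j" for i j
    using that by (simp add: d_def frac_le)
  then have "decseq A"
    unfolding A_def by (force simp: decseq_def)
  moreover have "range A \<subseteq> sets M"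
    by (auto simp: A_def)
  ultimately have "(\<lambda>k. measure M (A k)) \<longlonglongrightarrow> measure M (\<Inter>k. A k)"
    by (rule finite_Lim_measure_decseq[rotated])
  moreover have "(\<Inter>k. A k) = {}"
  proof -
    \<comment> \<open>A point with \<open>h x < 0\<close> leaves the strips as soon as
      \<open>d k < - h x\<close>; any other point lies in none of them.\<close>
    have "\<exists>k. x \<notin> A k" for x
    proof (cases "h x < 0")
      case True
      then obtain k where "d k < - h x"
        using nat_approx_posE[of "- h x"] unfolding d_def by auto
      then show ?thesis by (intro exI[of _ k]) (simp add: A_def)
    qed (simp add: A_def)
    then show ?thesis by blast
  qed
  ultimately have "(\<lambda>k. measure M (A k)) \<longlonglongrightarrow> 0"
    by simp
  then have "eventually (\<lambda>k. measure M (A k) < e / 2) sequentially"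
    using e by (intro order_tendstoD(2)) auto
  then obtain k where k: "measure M (A k) < e / 2"
    by (auto simp: eventually_sequentially)
  have d: "d k > 0"
    by (simp add: d_def)
  \<comment> \<open>With \<open>k\<close> now fixed independently of \<open>r\<close>, the factor
    \<open>d k\<close> offsets the division by \<open>d k\<close> in Markov's inequality and leaves
    \<open>e / 2\<close>.\<close>
  have "eventually (\<lambda>r. (LINT x|M. \<bar>q r x - h x\<bar>) < d k * (e / 2)) sequentially"
    using lim d e by (intro order_tendstoD(2)) auto
  then obtain N where N: "\<And>r. r \<ge> N \<Longrightarrow> (LINT x|M. \<bar>q r x - h x\<bar>) < d k * (e / 2)"
    by (auto simp: eventually_sequentially)
  have "measure M {x \<in> space M. q r x \<ge> 0 \<and> h x < 0} < e" if "r \<ge> N" for r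
  proof -
    define D where "D = {x \<in> space M. \<bar>q r x - h x\<bar> \<ge> d k}"
    have "measure M D \<le> (LINT x|M. \<bar>q r x - h x\<bar>) / d k"
      unfolding D_def using d q h
      by (intro integral_Markov_inequality_measure[where A = "{}"]) auto
    also have "\<dots> < e / 2"
      using N[OF that] d by (simp add: field_simps)
    finally have D: "measure M D < e / 2" .
    \<comment> \<open>Outside \<open>A k\<close> such a point has \<open>h x \<le> - d k\<close>, so
      \<open>q r x - h x \<ge> d k\<close> and it lies in \<open>D\<close>.\<close>
    have "measure M {x \<in> space M. q r x \<ge> 0 \<and> h x < 0} \<le> measure M (A k \<union> D)"
      by (rule finite_measure_mono) (auto simp: A_def D_def)
    also have "\<dots> \<le> measure M (A k) + measure M D"
      by (rule measure_Un_le) (auto simp: A_def D_def)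
    finally show ?thesis
      using k D by simp
  qed
  then show "\<exists>N. \<forall>r\<ge>N. norm (measure M {x \<in> space M. q r x \<ge> 0 \<and> h x < 0} - 0) < e"
    by auto
qed

theorem theorem3p2:
  fixes S :: "(real ^ 'n) set"
    and B :: "(real ^ 'm) set"
    and f :: "real ^ 'n \<Rightarrow> real ^ 'm"
    and p :: "nat \<Rightarrow> real ^ 'm \<Rightarrow> real"
  assumes "S \<noteq> {}" and "compact S" and "basic_semialgebraic S"
    and "polynomial_function f"
    and "compact B" and "basic_semialgebraic B"
    and "f ` S \<subseteq> B"
    and "\<And>r. real_polynomial_function (p r)"
    and "\<And>r x y. x \<in> S \<Longrightarrow> y \<in> B \<Longrightarrow> p r y \<ge> neg_sq_dist f x y"
    and "(\<lambda>r. LINT y|lebesgue_on B. \<bar>p r y - sup_neg_sq_dist S f y\<bar>) \<longlonglongrightarrow> 0"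
  shows "(\<forall>r. f ` S \<subseteq> superlevel_set B (p r)) \<and>
         (\<lambda>r. emeasure lebesgue (superlevel_set B (p r) - f ` S)) \<longlonglongrightarrow> 0"
proof (intro conjI allI)
  fix r
  \<comment> \<open>Take \<open>y = f x\<close>, which lies in \<open>B\<close>: there the lower
    bound \<open>neg_sq_dist f x y\<close> is 0.\<close>
  have "p r (f x) \<ge> 0" if "x \<in> S" for x
    using assms(9)[of x "f x" r] assms(7) that by (auto simp: neg_sq_dist_def)
  then show "f ` S \<subseteq> superlevel_set B (p r)"
    using assms(7) by (auto simp: superlevel_set_def)
next
  let ?h = "sup_neg_sq_dist S f"
  have F: "compact (f ` S)"
    using assms(2,4) by (intro compact_continuous_image continuous_on_polymonial_function)
  have h: "?h = (\<lambda>y. - (infdist y (f ` S))\<^sup>2)"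
    using sup_neg_sq_dist_eq_infdist[OF assms(1) F] by blast
  \<comment> \<open>As f(S) is closed and nonempty, its points are exactly those at distance
    0.\<close>
  have h_neg: "?h y < 0 \<longleftrightarrow> y \<notin> f ` S" for y
    using in_closed_iff_infdist_zero[OF compact_imp_closed[OF F], of y] assms(1)
    by (simp add: h)
  have B: "B \<in> sets lebesgue"
    using assms(5) by (simp add: compact_imp_closed borel_closed sets_completionI_sets)
  interpret finite_measure "lebesgue_on B"
    by (rule finite_measure_lebesgue_on) (simp add: assms(5) lmeasurable_compact)
  have "continuous_on B ?h"
    unfolding h by (intro continuous_intros)
  moreover have "continuous_on B (p r)" for r
    using assms(8) by (intro continuous_on_polymonial_function) (simp add: real_polynomial_function_eq)
  ultimately have "(\<lambda>r. measure (lebesgue_on B) {y \<in> space (lebesgue_on B). p r y \<ge> 0 \<and> ?h y < 0})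
      \<longlonglongrightarrow> 0"
    by (intro tendsto_measure_nonneg_of_L1_neg integrable_lebesgue_on_continuous_compact assms(5,10))
  then have "(\<lambda>r. emeasure (lebesgue_on B) {y \<in> space (lebesgue_on B). p r y \<ge> 0 \<and> ?h y < 0})
      \<longlonglongrightarrow> 0"
    unfolding emeasure_eq_measure using tendsto_ennrealI by fastforce
  moreover have "{y \<in> space (lebesgue_on B). p r y \<ge> 0 \<and> ?h y < 0} = superlevel_set B (p r) - f ` S"
    for r by (auto simp: superlevel_set_def h_neg)
  \<comment> \<open>The set lies inside \<open>B\<close>, so restricting the measure to
    \<open>B\<close> does not change its volume.\<close>
  moreover have "emeasure (lebesgue_on B) (superlevel_set B (p r) - f ` S)
      = emeasure lebesgue (superlevel_set B (p r) - f ` S)" for r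
    using B by (intro emeasure_restrict_space) (auto simp: superlevel_set_def)
  ultimately show "(\<lambda>r. emeasure lebesgue (superlevel_set B (p r) - f ` S)) \<longlonglongrightarrow> 0"
    by simp
qed

end
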